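(* There exists a real number $\alpha > 0$ such that $|\Gamma(n)| \ge \alpha \cdot 2^{n+1}$ holds for all integers $n \ge 0$.
   Context: For a non-negative integer $n$, let $[n]_0 := \{0,1,\dots,n\}$. For a set $X$ of integers, $X + X = \{x + y : x, y \in X\}$ (with $x = y$ allowed). An additive 2-base for $n$ is a subset $X \subseteq [n]_0$ such that $[n]_0 \subseteq X + X$. $\Gamma(n)$ denotes the family of all additive 2-bases for $n$. *)

theory Defs
  imports Complex_Main "HOL-Library.Set_Algebras"
begin

text \<open>Every set involved lies in \<open>{0..n}\<close>, so integers are represented by type \<open>nat\<close>.
  \<open>X + X\<close> is the sumset of \<open>HOL-Library.Set_Algebras\<close>, in which equal summands are allowed.\<close>

definition additive_2_base :: "nat \<Rightarrow> nat set \<Rightarrow> bool" where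
  "additive_2_base n X \<longleftrightarrow> X \<subseteq> {0..n} \<and> {0..n} \<subseteq> X + X"

definition Gamma_bases :: "nat \<Rightarrow> nat set set" where
  "Gamma_bases n = {X. additive_2_base n X}"

end

theory Submission
  imports Defs
begin

text \<open>Consider only the sets \<open>X = {0..3} \<union> Y\<close> with \<open>Y \<subseteq> {4..n}\<close> chosen uniformly at random. Every
  \<open>m \<le> 6\<close> is a sum of two elements of \<open>{0..3}\<close>. For \<open>m \<ge> 7\<close> to be missed, none of
  \<open>m - 3, \<dots>, m\<close> may lie in \<open>Y\<close>, and none of the disjoint pairs \<open>{i, m - i}\<close> with
  \<open>4 \<le> i < m/2\<close> may be contained in \<open>Y\<close>; this has probability at most
  \<open>1/16 * (3/4) ^ ((m - 7) div 2)\<close>. These bounds add up to at most \<open>1/2\<close>, so at least half of the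
  sets \<open>X\<close> are bases.\<close>

text \<open>The pairs \<open>{j, f j}\<close> are disjoint two-element sets, and each admits three
  of its four possible traces, so each costs an independent factor 3/4. The induction splits off one
  pair at a time.\<close>

lemma card_subsets_without_pairs:
  assumes "finite A" "J \<subseteq> A" "f ` J \<subseteq> A" "inj_on f J" "f ` J \<inter> J = {}"
  shows "real (card {X. X \<subseteq> A \<and> (\<forall>j\<in>J. \<not> (j \<in> X \<and> f j \<in> X))}) \<le> (3/4) ^ card J * 2 ^ card A"
proof -
  have "finite J"
    using assms finite_subset by blast
  then show ?thesis
    using assms
  proof (induction J arbitrary: A rule: finite_induct)
    case empty
    then show ?case
      using card_Pow[of A] by (simp add: Pow_def)
  next
    case (insert j J)
    define A' where "A' = A - {j, f j}"
    define N where "N = (\<lambda>A J. {X. X \<subseteq> A \<and> (\<forall>j\<in>J. \<not> (j \<in> X \<and> f j \<in> X))})"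
    have "j \<in> A" "f j \<in> A" "j \<noteq> f j"
      using insert.prems by auto
    then have A: "A = insert j (insert (f j) A')" "j \<notin> insert (f j) A'" "f j \<notin> A'"
      by (auto simp: A'_def)
    have "finite A'"
      using insert.prems by (simp add: A'_def)
    then have card_A: "card A = card A' + 2"
      using A by simp
    have "f i \<noteq> f j" if "i \<in> J" for i
      using insert.prems(4) insert.hyps(2) that by (metis inj_on_contraD insertCI)
    then have "J \<subseteq> A'" "f ` J \<subseteq> A'"
      using insert.prems insert.hyps(2) by (auto simp: A'_def)
    then have IH: "real (card (N A' J)) \<le> (3/4) ^ card J * 2 ^ card A'"
      unfolding N_def using insert.prems \<open>finite A'\<close> by (intro insert.IH) auto
    \<comment> \<open>The permitted traces on the pair; together with \<open>X \<inter> A'\<close>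
      such a trace determines \<open>X\<close>.\<close>
    define T where "T = {{}, {j}, {f j}}"
    have "card (N A (insert j J)) \<le> card (N A' J \<times> T)"
    proof (rule card_inj_on_le)
      show "inj_on (\<lambda>X. (X \<inter> A', X - A')) (N A (insert j J))"
        by (rule inj_onI) blast
      show "(\<lambda>X. (X \<inter> A', X - A')) ` N A (insert j J) \<subseteq> N A' J \<times> T"
        by (auto simp: N_def T_def A'_def)
      show "finite (N A' J \<times> T)"
        using \<open>finite A'\<close> by (auto simp: N_def T_def)
    qed
    moreover have "card T = 3"
      using \<open>j \<noteq> f j\<close> by (simp add: T_def)
    ultimately have "real (card (N A (insert j J))) \<le> 3 * real (card (N A' J))"
      by (simp add: card_cartesian_product flip: of_nat_le_iff[where 'a = real])
    also have "\<dots> \<le> 3 * ((3/4) ^ card J * 2 ^ card A')"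
      using IH by simp
    also have "\<dots> = (3/4) ^ card (insert j J) * 2 ^ card A"
      using insert.hyps card_A by (simp add: power_add)
    finally show ?case
      unfolding N_def .
  qed
qed

text \<open>Every exponent occurs at most twice, so twice the geometric series with ratio 3/4 is a
  bound. Padding to \<open>2 * N\<close> terms makes a closed form available.\<close>

lemma sum_power_half_le:
  "(\<Sum>k<N. (3/4::real) ^ (k div 2)) \<le> 8"
proof -
  have "(\<Sum>k<2 * M. (3/4::real) ^ (k div 2)) = 8 * (1 - (3/4) ^ M)" for M
    by (induction M) (simp_all add: algebra_simps)
  moreover have "(\<Sum>k<N. (3/4::real) ^ (k div 2)) \<le> (\<Sum>k<2 * N. (3/4) ^ (k div 2))"
    by (rule sum_mono2) auto
  ultimately have "(\<Sum>k<N. (3/4::real) ^ (k div 2)) \<le> 8 * (1 - (3/4) ^ N)"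
    by simp
  also have "\<dots> \<le> 8"
    by simp
  finally show ?thesis .
qed

lemma card_missing_sum_le:
  assumes "7 \<le> m" "m \<le> n"
  shows "real (card {Y. Y \<subseteq> {4..n} \<and> m \<notin> ({0..3} \<union> Y) + ({0..3} \<union> Y)})
           \<le> 2 ^ n / 128 * (3/4) ^ ((m - 7) div 2)"
proof -
  \<comment> \<open>Since 7 \<le> m \<le> n, exactly four of the n - 3 free elements are removed; n
    - 7 remain, whence 128 = 2^7.\<close>
  define A where "A = {4..n} - {m-3..m}"
  \<comment> \<open>The upper bound says 2j < m, so j and m - j differ and the pairs are disjoint; 4
    \<le> j keeps m - j below m - 3.\<close>
  define J where "J = {4..<(m + 1) div 2}"
  define N where "N = {Y. Y \<subseteq> A \<and> (\<forall>j\<in>J. \<not> (j \<in> Y \<and> m - j \<in> Y))}"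
  have "{Y. Y \<subseteq> {4..n} \<and> m \<notin> ({0..3} \<union> Y) + ({0..3} \<union> Y)} \<subseteq> N"
  proof clarify
    fix Y assume Y: "Y \<subseteq> {4..n}" "m \<notin> ({0..3} \<union> Y) + ({0..3} \<union> Y)"
    have no_sum: "a + b \<noteq> m" if "a \<in> {0..3} \<union> Y" "b \<in> {0..3} \<union> Y" for a b
      using Y(2) that set_plus_intro by metis
    \<comment> \<open>Otherwise m - y would lie in the fixed block \<open>{0..3}\<close> and
      complete y to m.\<close>
    have "y \<notin> {m-3..m}" if "y \<in> Y" for y
      using no_sum[of "m - y" y] that by (auto simp: le_diff_conv)
    moreover have "\<not> (j \<in> Y \<and> m - j \<in> Y)" if "j \<in> J" for j
      using no_sum[of j "m - j"] that by (auto simp: J_def)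
    ultimately show "Y \<in> N"
      using Y(1) by (auto simp: N_def A_def)
  qed
  moreover have "finite N"
    by (simp add: N_def A_def)
  ultimately have "card {Y. Y \<subseteq> {4..n} \<and> m \<notin> ({0..3} \<union> Y) + ({0..3} \<union> Y)} \<le> card N"
    by (rule card_mono[rotated])
  moreover have "real (card N) \<le> (3/4) ^ card J * 2 ^ card A"
    unfolding N_def
  proof (rule card_subsets_without_pairs)
    show "J \<subseteq> A" "(-) m ` J \<subseteq> A" "(-) m ` J \<inter> J = {}"
      using assms by (auto simp: J_def A_def)
    show "inj_on ((-) m) J"
      by (rule inj_onI) (auto simp: J_def)
  qed (simp add: A_def)
  moreover have "card J = (m - 7) div 2"
    using assms by (simp add: J_def)
  moreover have "2 ^ card A = (2::real) ^ n / 128"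
  proof -
    have "card A = card {4..n} - card {m-3..m}"
      unfolding A_def using assms by (intro card_Diff_subset) auto
    then have "card A = n - 7"
      using assms by simp
    then show ?thesis
      using assms by (simp add: power_diff)
  qed
  ultimately show ?thesis
    by (simp add: mult.commute)
qed

lemma initial_segment_sum:
  fixes m :: nat
  assumes "m \<le> 2 * k"
  shows "m \<in> {0..k} + {0..k}"
proof -
  have "min m k + (m - min m k) \<in> {0..k} + {0..k}"
    using assms by (intro set_plus_intro) auto
  then show ?thesis
    by simp
qed

lemma finite_Gamma_bases: "finite (Gamma_bases n)"
  by (rule finite_subset[of _ "Pow {0..n}"]) (auto simp: Gamma_bases_def additive_2_base_def)

lemma card_Gamma_bases_ge_of_ge_3:
  assumes "3 \<le> n"
  shows "real (card (Gamma_bases n)) \<ge> 2 ^ n / 16"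
proof -
  define S where "S = (\<lambda>Y. ({0..3::nat} \<union> Y) + ({0..3} \<union> Y))"
  define G where "G = {Y. Y \<subseteq> {4..n} \<and> {0..n} \<subseteq> S Y}"
  define B where "B = (\<lambda>m. {Y. Y \<subseteq> {4..n} \<and> m \<notin> S Y})"
  have small: "m \<in> S Y" if "m < 7" for m Y
    using initial_segment_sum[of m 3] set_plus_mono2[of "{0..3}" "{0..3} \<union> Y" "{0..3}" "{0..3} \<union> Y"] that
    unfolding S_def by auto
  \<comment> \<open>Union bound: a choice of \<open>Y\<close> outside \<open>G\<close> misses some
    m, and by \<open>small\<close> this m is at least 7.\<close>
  have "Pow {4..n} \<subseteq> G \<union> (\<Union>m\<in>{7..n}. B m)"
    using small by (fastforce simp: G_def B_def not_less)
  moreover have fin: "finite G" "finite (B m)" for m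
    by (simp_all add: G_def B_def)
  ultimately have "card (Pow {4..n}) \<le> card (G \<union> (\<Union>m\<in>{7..n}. B m))"
    by (intro card_mono) auto
  also have "\<dots> \<le> card G + card (\<Union>m\<in>{7..n}. B m)"
    by (rule card_Un_le)
  also have "\<dots> \<le> card G + (\<Sum>m\<in>{7..n}. card (B m))"
    by (simp add: card_UN_le)
  finally have "real (card (Pow {4..n})) \<le> real (card G) + (\<Sum>m\<in>{7..n}. real (card (B m)))"
    by (simp flip: of_nat_sum of_nat_add)
  moreover have "real (card (Pow {4..n})) = 2 ^ n / 8"
    using assms power_diff[of "2::real" 3 n] by (simp add: card_Pow)
  moreover have "(\<Sum>m\<in>{7..n}. real (card (B m))) \<le> 2 ^ n / 16"
  proof -
    have "(\<Sum>m\<in>{7..n}. real (card (B m))) \<le> (\<Sum>m\<in>{7..n}. 2 ^ n / 128 * (3/4) ^ ((m - 7) div 2))"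
      unfolding B_def S_def by (intro sum_mono card_missing_sum_le) auto
    also have "\<dots> = 2 ^ n / 128 * (\<Sum>m\<in>{7..n}. (3/4) ^ ((m - 7) div 2))"
      by (rule sum_distrib_left[symmetric])
    also have "(\<Sum>m\<in>{7..n}. (3/4::real) ^ ((m - 7) div 2)) = (\<Sum>k<n + 1 - 7. (3/4) ^ (k div 2))"
      by (rule sum.reindex_bij_witness[of _ "\<lambda>k. k + 7" "\<lambda>m. m - 7"]) auto
    \<comment> \<open>8/128 = 1/16 is half of the total share 1/8.\<close>
    also have "2 ^ n / 128 * \<dots> \<le> 2 ^ n / 128 * (8::real)"
      by (intro mult_left_mono sum_power_half_le) simp
    finally show ?thesis
      by simp
  qed
  ultimately have "2 ^ n / 16 \<le> real (card G)"
    by linarith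
  moreover have "card G \<le> card (Gamma_bases n)"
  proof (rule card_inj_on_le[OF _ _ finite_Gamma_bases])
    \<comment> \<open>\<open>Y\<close> is disjoint from the block, so removing the block recovers
      it.\<close>
    show "inj_on ((\<union>) {0..3}) G"
    proof (rule inj_on_inverseI)
      show "({0..3} \<union> Y) - {0..3} = Y" if "Y \<in> G" for Y
        using that by (fastforce simp: G_def)
    qed
    show "(\<union>) {0..3} ` G \<subseteq> Gamma_bases n"
      using assms by (auto simp: G_def S_def Gamma_bases_def additive_2_base_def)
  qed
  ultimately show ?thesis
    by linarith
qed

lemma card_Gamma_bases_pos: "card (Gamma_bases n) > 0"
proof -
  have "{0..n} \<in> Gamma_bases n"
    by (auto simp: Gamma_bases_def additive_2_base_def intro!: initial_segment_sum)
  then show ?thesis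
    using finite_Gamma_bases by (auto simp: card_gt_0_iff)
qed

theorem theorem1p1:
  shows "\<exists>\<alpha>::real. \<alpha> > 0 \<and> (\<forall>n::nat. real (card (Gamma_bases n)) \<ge> \<alpha> * 2 ^ (n + 1))"
\<comment> \<open>For n \<ge> 3 this is the bound 2^n/16 rewritten. For n < 3 the block
  \<open>{0..3}\<close> does not fit, but the target is at most 8/32, so a single base
  suffices.\<close>
proof (intro exI[of _ "1/32"] conjI allI)
  fix n :: nat
  show "real (card (Gamma_bases n)) \<ge> 1/32 * 2 ^ (n + 1)"
  proof (cases "3 \<le> n")
    case True
    then show ?thesis
      using card_Gamma_bases_ge_of_ge_3 by simp
  next
    case False
    then have "(2::real) ^ (n + 1) \<le> 2 ^ 3"
      by (intro power_increasing) auto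
    moreover have "real (card (Gamma_bases n)) \<ge> 1"
      using card_Gamma_bases_pos[of n] by simp
    ultimately show ?thesis
      by simp
  qed
qed simp

end
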